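(* Let $\xi$ be an $L_2$-norm power function of order $r_\xi>1$, and suppose that $G(\theta,z)$ is an $r_\xi$-degree $\mathcal{H}(\xi)$-smooth function of $\theta\in\mathbb{R}^m$ for every $z\in\mathcal{Z}$. Consider the SGD iteration $\theta_{k+1}=\theta_k-\alpha\,g(\theta_k,s_k)$, where $s_k$ is a mini-batch sampled from the dataset $s$ and $g(\theta_k,s_k)$ is the stochastic gradient at iteration $k$. Write $r_{\xi^*}=r_\xi/(r_\xi-1)$ and $\bar\xi=r_\xi\,\xi$. Then the following statements hold: 1. The optimal learning rate is achieved when $$\alpha=\left(\frac{\|g(\theta_k,s_k)\|_2^2}{r_\xi\,\xi(g(\theta_k,s_k))}\right)^{1/(r_\xi-1)}.$$ Under this choice, the following inequality holds: $$G(\theta_{k+1},s_k)\le G(\theta_k,s_k)-r_{\xi^*}^{-1}\left(\frac{\|g(\theta_k,s_k)\|_2^2}{\bar\xi(g(\theta_k,s_k))}\right)^{r_{\xi^*}}.$$ 2. If the mini-batch $s_k$ is selected such that $$G(\theta_{k+1},s)-G(\theta_k,s)\le\beta\big(G(\theta_{k+1},s_k)-G(\theta_k,s_k)\big)$$ for some constant $\beta>0$, then to achieve $\mathbb{E}\|\nabla G(\theta_k,s_k)\|_2^{r_{\xi^*}}\le\varepsilon^{r_{\xi^*}}$, the required number of iterations $T$ satisfies $T=\mathcal{O}\left(\varepsilon^{-r_{\xi^*}}\right)$.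
   Context: An $L_2$-norm power function of order $r_\xi>1$ and scale $a_\xi>0$ is $\xi(\mu)=\|a_\xi\mu\|_2^{r_\xi}/r_\xi$. A real-valued function $F$ is $\mathcal{H}(\xi)$-smooth if $F(\mu)-F(\nu)-\langle\nabla F(\nu),\mu-\nu\rangle\le\xi(\mu-\nu)$ for all $\mu,\nu$ in its domain. The data points $z$ lie in a set $\mathcal{Z}$; $s$ is the dataset, with empirical distribution $\hat q$. For a mini-batch $s_k$ sampled from $s$, with $|s_k|$ samples, $G(\theta,s_k)=\frac1{|s_k|}\sum_{z\in s_k}G(\theta,z)$, and $G(\theta,s)=\mathbb{E}_{Z\sim\hat q}G(\theta,Z)$. The optimization problem is $\min_\theta G(\theta,s)$, with minimum value $G_*$. The stochastic gradient is $g(\theta_k,s_k)=\nabla_\theta G(\theta_k,s_k)$; $\theta_k$ is the parameter value at iteration $k$ and $\alpha$ is the learning rate. "Optimal" learning rate means the one minimizing the smoothness upper bound $-\alpha\|g(\theta_k,s_k)\|_2^2+\xi(\alpha g(\theta_k,s_k))$ on $G(\theta_{k+1},s_k)-G(\theta_k,s_k)$.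
   Formalization: Part 1's printed inequality is false; ξ̄(g) is replaced by ξ̄(g)^{1/r_ξ}, and the printed form is kept when ξ̄(g) ≥ 1. Part 2 uses part 1's learning rate and bounds the expectation averaged over iterations and at some iterate. *)

theory Defs
  imports "HOL-Probability.Probability" "HOL-Library.Landau_Symbols"
begin

text \<open>On \<open>real^'m\<close> the norm is the Euclidean one.\<close>

definition norm_power :: "real \<Rightarrow> real \<Rightarrow> real^'m \<Rightarrow> real" where
  "norm_power a r \<mu> = norm (a *\<^sub>R \<mu>) powr r / r"

definition gradient :: "('a::real_inner \<Rightarrow> real) \<Rightarrow> 'a \<Rightarrow> 'a" where
  "gradient F x = (THE D. GDERIV F x :> D)"

definition H_smooth :: "('a::real_inner \<Rightarrow> real) \<Rightarrow> ('a \<Rightarrow> real) \<Rightarrow> bool" where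
  "H_smooth \<xi> F \<longleftrightarrow> (\<forall>\<nu>. \<exists>D. GDERIV F \<nu> :> D) \<and>
     (\<forall>\<mu> \<nu>. F \<mu> - F \<nu> - gradient F \<nu> \<bullet> (\<mu> - \<nu>) \<le> \<xi> (\<mu> - \<nu>))"

text \<open>Datasets and mini-batches are finite multisets of data points, so that repeated data
  points and sampling with or without replacement are all covered.\<close>

definition minibatches :: "'z multiset \<Rightarrow> 'z multiset set" where
  "minibatches s = {b. b \<noteq> {#} \<and> set_mset b \<subseteq> set_mset s}"

definition batch_loss :: "('p \<Rightarrow> 'z \<Rightarrow> real) \<Rightarrow> 'p \<Rightarrow> 'z multiset \<Rightarrow> real" where
  "batch_loss G \<theta> b = (\<Sum>z\<in>#b. G \<theta> z) / real (size b)"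

definition full_loss :: "('p \<Rightarrow> 'z \<Rightarrow> real) \<Rightarrow> 'p \<Rightarrow> 'z multiset \<Rightarrow> real" where
  "full_loss G \<theta> s = measure_pmf.expectation (pmf_of_multiset s) (G \<theta>)"

definition stoch_grad :: "('p::real_inner \<Rightarrow> 'z \<Rightarrow> real) \<Rightarrow> 'p \<Rightarrow> 'z multiset \<Rightarrow> 'p" where
  "stoch_grad G \<theta> b = gradient (\<lambda>\<theta>'. batch_loss G \<theta>' b) \<theta>"

definition optimal_learning_rate :: "('a::real_inner \<Rightarrow> real) \<Rightarrow> 'a \<Rightarrow> real \<Rightarrow> bool" where
  "optimal_learning_rate \<xi> g \<alpha> \<longleftrightarrow>
     is_arg_min (\<lambda>t. - t * (norm g)\<^sup>2 + \<xi> (t *\<^sub>R g)) (\<lambda>_. True) \<alpha>"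

text \<open>At \<open>g = 0\<close> the quotient is \<open>0 / 0 = 0\<close> and the learning rate is \<open>0\<close>;
  the step \<open>\<alpha> *\<^sub>R g\<close> vanishes there for every \<open>\<alpha>\<close>.\<close>

definition optimal_rate_formula :: "real \<Rightarrow> ('a::real_inner \<Rightarrow> real) \<Rightarrow> 'a \<Rightarrow> real" where
  "optimal_rate_formula r \<xi> g = ((norm g)\<^sup>2 / (r * \<xi> g)) powr (1 / (r - 1))"

text \<open>The mini-batches \<open>S k\<close> may have any joint law, and may depend on each other.\<close>

definition sgd_run ::
  "'w measure \<Rightarrow> ('p::real_inner \<Rightarrow> 'z \<Rightarrow> real) \<Rightarrow> 'z multiset \<Rightarrow> 'p \<Rightarrow> (nat \<Rightarrow> 'w \<Rightarrow> real) \<Rightarrow>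
   (nat \<Rightarrow> 'w \<Rightarrow> 'z multiset) \<Rightarrow> (nat \<Rightarrow> 'w \<Rightarrow> 'p) \<Rightarrow> bool" where
  "sgd_run M G s \<theta>\<^sub>0 \<alpha> S \<theta> \<longleftrightarrow>
     (\<forall>k. S k \<in> M \<rightarrow>\<^sub>M count_space (minibatches s)) \<and>
     (\<forall>\<omega>\<in>space M. \<theta> 0 \<omega> = \<theta>\<^sub>0) \<and>
     (\<forall>k. \<forall>\<omega>\<in>space M.
        \<theta> (Suc k) \<omega> = \<theta> k \<omega> - \<alpha> k \<omega> *\<^sub>R stoch_grad G (\<theta> k \<omega>) (S k \<omega>))"

text \<open>
  Pitfall: with \<open>\<xi>_bar = r * \<xi>\<close>, substituting the optimal learning rate into
  \<open>- \<alpha> * (norm g)\<^sup>2 + \<xi> (\<alpha> *\<^sub>R g)\<close> gives minus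
  \<open>1 / r_star * ((norm g)\<^sup>2 / \<xi>_bar g powr (1 / r)) powr r_star\<close>, where \<open>r_star = r / (r - 1)\<close>.
  Here \<open>\<xi>_bar g powr (1 / r) = norm (a *\<^sub>R g)\<close>. That decrease is \<open>\<xi>_bar g\<close> times the one
  with the exponent \<open>1 / r\<close> left out, which is therefore valid if \<open>\<xi>_bar g \<ge> 1\<close> but not in
  general: for \<open>G \<theta> z = (norm \<theta>)\<^sup>2 / 2\<close>, \<open>a = 1\<close> and \<open>r = 2\<close> it is the constant \<open>1 / 2\<close> for
  every \<open>\<theta> \<noteq> 0\<close>, although \<open>G \<theta> z\<close> exceeds its minimum by less than that if \<open>norm \<theta> < 1\<close>.
\<close>

definition xi_bar :: "real \<Rightarrow> ('a \<Rightarrow> real) \<Rightarrow> 'a \<Rightarrow> real" where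
  "xi_bar r \<xi> \<mu> = r * \<xi> \<mu>"

end

theory Submission
  imports Defs
begin

text \<open>
  Part 1: along \<open>g\<close> the smoothness bound is the one-variable function
  \<open>- t * b + \<bar>t\<bar> powr r * c / r\<close>; its minimizer solves \<open>t powr (r - 1) * c = b\<close>, and strict
  convexity enters through the tangent inequality \<open>1 + r * (u - 1) < u powr r\<close>. The minimal value
  is \<open>- (norm g / a) powr r_star / r_star\<close>.

  Part 2: each step therefore lowers the full loss by a multiple of
  \<open>norm g powr r_star\<close>, almost surely. Telescoping bounds the sum of these quantities by a constant
  independent of the number of steps. Measurability of the iterates holds because there are only
  countably many mini-batches, so that each iterate takes countably many values.
\<close>

section \<open>Gradients and the calculus of smooth functions\<close>

lemma gradient_eqI:
  assumes "GDERIV F x :> D"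
  shows "gradient F x = D"
  unfolding gradient_def
proof (rule the_equality)
  fix E assume "GDERIV F x :> E"
  then have "(\<lambda>h. h \<bullet> E) = (\<lambda>h. h \<bullet> D)"
    using assms unfolding gderiv_def by (rule has_derivative_unique)
  \<comment> \<open>Testing the two equal functionals at the vector \<open>E - D\<close> makes its
    squared norm vanish.\<close>
  then have "(E - D) \<bullet> E = (E - D) \<bullet> D"
    by (rule fun_cong)
  then have "(E - D) \<bullet> (E - D) = 0"
    by (simp add: inner_diff_right)
  then show "E = D" by simp
qed (fact assms)

lemma H_smoothI:
  assumes "\<And>\<nu>. GDERIV F \<nu> :> D \<nu>"
    and "\<And>\<mu> \<nu>. F \<mu> - F \<nu> - D \<nu> \<bullet> (\<mu> - \<nu>) \<le> \<xi> (\<mu> - \<nu>)"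
  shows "H_smooth \<xi> F"
  using assms gradient_eqI[OF assms(1)] unfolding H_smooth_def by auto

lemma H_smoothD:
  assumes "H_smooth \<xi> F"
  shows "GDERIV F \<nu> :> gradient F \<nu>"
    and "F \<mu> - F \<nu> - gradient F \<nu> \<bullet> (\<mu> - \<nu>) \<le> \<xi> (\<mu> - \<nu>)"
proof -
  obtain D where "GDERIV F \<nu> :> D"
    using assms unfolding H_smooth_def by blast
  then show "GDERIV F \<nu> :> gradient F \<nu>"
    using gradient_eqI by metis
  show "F \<mu> - F \<nu> - gradient F \<nu> \<bullet> (\<mu> - \<nu>) \<le> \<xi> (\<mu> - \<nu>)"
    using assms unfolding H_smooth_def by blast
qed

lemma H_smooth_add:
  assumes "H_smooth \<xi> F" and "H_smooth \<eta> H"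
  shows "H_smooth (\<lambda>\<mu>. \<xi> \<mu> + \<eta> \<mu>) (\<lambda>\<theta>. F \<theta> + H \<theta>)"
proof (rule H_smoothI)
  show "GDERIV (\<lambda>\<theta>. F \<theta> + H \<theta>) \<nu> :> gradient F \<nu> + gradient H \<nu>" for \<nu>
    by (intro GDERIV_add H_smoothD(1)[OF assms(1)] H_smoothD(1)[OF assms(2)])
  show "F \<mu> + H \<mu> - (F \<nu> + H \<nu>) - (gradient F \<nu> + gradient H \<nu>) \<bullet> (\<mu> - \<nu>)
      \<le> \<xi> (\<mu> - \<nu>) + \<eta> (\<mu> - \<nu>)" for \<mu> \<nu>
    using H_smoothD(2)[OF assms(1), of \<mu> \<nu>] H_smoothD(2)[OF assms(2), of \<mu> \<nu>]
    by (simp add: inner_add_left)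
qed

lemma H_smooth_cmult:
  assumes "H_smooth \<xi> F" and "c \<ge> 0"
  shows "H_smooth (\<lambda>\<mu>. c * \<xi> \<mu>) (\<lambda>\<theta>. c * F \<theta>)"
proof (rule H_smoothI)
  show "GDERIV (\<lambda>\<theta>. c * F \<theta>) \<nu> :> c *\<^sub>R gradient F \<nu>" for \<nu>
    using GDERIV_mult[OF GDERIV_const[of c \<nu>] H_smoothD(1)[OF assms(1), of \<nu>]] by simp
  show "c * F \<mu> - c * F \<nu> - (c *\<^sub>R gradient F \<nu>) \<bullet> (\<mu> - \<nu>) \<le> c * \<xi> (\<mu> - \<nu>)" for \<mu> \<nu>
    using mult_left_mono[OF H_smoothD(2)[OF assms(1), of \<mu> \<nu>] assms(2)]
    by (simp add: algebra_simps)
qed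

text \<open>Smoothness bounds add up over the summands, with multiplicity. The division by
  \<open>size b\<close> in \<open>batch_loss\<close> later cancels the factor, so that an average of
  smooth functions keeps the same \<open>\<xi>\<close>.\<close>

lemma H_smooth_sum_mset:
  assumes "\<And>z. z \<in># b \<Longrightarrow> H_smooth \<xi> (\<lambda>\<theta>. G \<theta> z)"
  shows "H_smooth (\<lambda>\<mu>. real (size b) * \<xi> \<mu>) (\<lambda>\<theta>. \<Sum>z\<in>#b. G \<theta> z)"
  using assms
proof (induction b)
  case empty
  show ?case
    by (rule H_smoothI[where D = "\<lambda>_. 0"]) (auto intro: GDERIV_const)
next
  case (add z b)
  then have "H_smooth (\<lambda>\<mu>. \<xi> \<mu> + real (size b) * \<xi> \<mu>) (\<lambda>\<theta>. G \<theta> z + (\<Sum>z\<in>#b. G \<theta> z))"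
    by (intro H_smooth_add) auto
  then show ?case
    by (simp add: algebra_simps)
qed

lemma H_smooth_batch_loss:
  assumes "b \<noteq> {#}" and "\<And>z. z \<in># b \<Longrightarrow> H_smooth \<xi> (\<lambda>\<theta>. G \<theta> z)"
  shows "H_smooth \<xi> (\<lambda>\<theta>. batch_loss G \<theta> b)"
proof -
  have "H_smooth (\<lambda>\<mu>. (1 / real (size b)) * (real (size b) * \<xi> \<mu>))
    (\<lambda>\<theta>. (1 / real (size b)) * (\<Sum>z\<in>#b. G \<theta> z))"
    using assms(2) by (rule H_smooth_cmult[OF H_smooth_sum_mset]) auto
  then show ?thesis
    using assms(1) by (simp add: batch_loss_def)
qed

text \<open>Smoothness between \<open>x\<close> and \<open>x - t *\<^sub>R gradient F x\<close>: the
  inner product collapses to \<open>- t\<close> times the squared norm of the gradient, which gives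
  the bound that a learning rate is to minimize.\<close>

lemma H_smooth_gradient_step:
  assumes "H_smooth \<xi> F"
  shows "F (x - t *\<^sub>R gradient F x) \<le>
    F x + (- t * (norm (gradient F x))\<^sup>2 + \<xi> (- t *\<^sub>R gradient F x))"
proof -
  let ?g = "gradient F x"
  have "F (x - t *\<^sub>R ?g) - F x - ?g \<bullet> (x - t *\<^sub>R ?g - x) \<le> \<xi> (x - t *\<^sub>R ?g - x)"
    using assms unfolding H_smooth_def by blast
  then show ?thesis
    by (simp add: power2_norm_eq_inner)
qed

section \<open>Minimizing the one-variable bound\<close>

text \<open>Strict Bernoulli inequality. By the mean value theorem the secant slope between
  \<open>u\<close> and 1 is \<open>r * z powr (r - 1)\<close> for some \<open>z\<close> in between,
  which is below \<open>r\<close> to the left of 1 and above \<open>r\<close> to the right. The case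
  \<open>u = 0\<close> is checked directly, so that the mean value theorem is applied on positive
  intervals only.\<close>

lemma tangent_less_powr:
  fixes u r :: real
  assumes "r > 1" and "u \<ge> 0" and "u \<noteq> 1"
  shows "1 + r * (u - 1) < u powr r"
proof -
  consider "u = 0" | "0 < u" "u < 1" | "1 < u"
    using assms by linarith
  then show ?thesis
  proof cases
    case 1
    with assms show ?thesis by simp
  next
    case 2
    have "\<exists>z. u < z \<and> z < 1 \<and> 1 powr r - u powr r = (1 - u) * (r * z powr (r - 1))"
      using 2 by (intro MVT2) (auto intro!: derivative_eq_intros)
    then obtain z where z: "u < z" "z < 1" "1 powr r - u powr r = (1 - u) * (r * z powr (r - 1))"
      by blast
    have "z powr (r - 1) < 1"
      using z 2 assms powr_less_mono2[of "r - 1" z 1] by simp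
    then have "(1 - u) * (r * z powr (r - 1)) < (1 - u) * (r * 1)"
      using 2 assms by (intro mult_strict_left_mono) auto
    with z(3) show ?thesis by (simp add: algebra_simps)
  next
    case 3
    have "\<exists>z. 1 < z \<and> z < u \<and> u powr r - 1 powr r = (u - 1) * (r * z powr (r - 1))"
      using 3 by (intro MVT2) (auto intro!: derivative_eq_intros)
    then obtain z where z: "1 < z" "z < u" "u powr r - 1 powr r = (u - 1) * (r * z powr (r - 1))"
      by blast
    have "1 < z powr (r - 1)"
      using z assms powr_less_mono2[of "r - 1" 1 z] by simp
    then have "(u - 1) * (r * 1) < (u - 1) * (r * z powr (r - 1))"
      using 3 assms by (intro mult_strict_left_mono) auto
    with z(3) show ?thesis by (simp add: algebra_simps)
  qed
qed

text \<open>The fourth assumption says that the derivative vanishes at \<open>\<alpha>\<close>. It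
  gives \<open>\<alpha> powr r * c = \<alpha> * b\<close>, so dividing both sides by
  \<open>\<alpha> * b\<close> leaves a comparison in \<open>t / \<alpha>\<close> and
  \<open>u = \<bar>t\<bar> / \<alpha>\<close> alone.\<close>

lemma power_bound_strict_min:
  fixes \<alpha> b c r t :: real
  assumes "r > 1" and "\<alpha> > 0" and "b > 0" and "\<alpha> powr (r - 1) * c = b" and "t \<noteq> \<alpha>"
  shows "- \<alpha> * b + \<alpha> powr r * c / r < - t * b + \<bar>t\<bar> powr r * c / r"
proof -
  define u where "u = \<bar>t\<bar> / \<alpha>"
  have \<alpha>r: "\<alpha> powr r * c = \<alpha> * b"
    unfolding assms(4)[symmetric] using assms(2) powr_mult_base[of \<alpha> "r - 1"] by simp
  have tr: "\<bar>t\<bar> powr r * c = u powr r * (\<alpha> * b)"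
    unfolding \<alpha>r[symmetric] using assms(2) by (simp add: u_def powr_divide)
  have ua: "\<bar>t\<bar> = u * \<alpha>"
    using assms by (simp add: u_def)
  have u0: "u \<ge> 0"
    using assms by (simp add: u_def)
  have P: "\<alpha> * b > 0"
    using assms by simp
  have "- 1 + 1 / r < - (t / \<alpha>) + u powr r / r"
  \<comment> \<open>For \<open>u = 1\<close> the tangent inequality is not strict, but then
    \<open>t = - \<alpha>\<close> and the linear term alone decides. Otherwise
    \<open>t / \<alpha>\<close> is at most \<open>u\<close>, and the strict tangent inequality at
    \<open>u\<close> suffices.\<close>
  proof (cases "u = 1")
    case True
    then have "t / \<alpha> = - 1"
      using ua assms by (auto simp: abs_if split: if_splits)
    with True show ?thesis by simp
  next
    case False
    have "t / \<alpha> \<le> u"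
      using assms by (simp add: u_def divide_right_mono)
    moreover have "(1 + r * (u - 1)) / r < u powr r / r"
      using tangent_less_powr[OF assms(1) u0 False] assms by (intro divide_strict_right_mono) auto
    moreover have "(1 + r * (u - 1)) / r = 1 / r + (u - 1)"
      using assms by (simp add: field_simps)
    ultimately show ?thesis by linarith
  qed
  then have "(\<alpha> * b) * (- 1 + 1 / r) < (\<alpha> * b) * (- (t / \<alpha>) + u powr r / r)"
    using P by (rule mult_strict_left_mono)
  moreover have "(\<alpha> * b) * (- (t / \<alpha>) + u powr r / r) = - t * b + \<bar>t\<bar> powr r * c / r"
    unfolding tr using assms by (simp add: field_simps)
  moreover have "(\<alpha> * b) * (- 1 + 1 / r) = - \<alpha> * b + \<alpha> powr r * c / r"
    unfolding \<alpha>r by (simp add: field_simps)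
  ultimately show ?thesis by simp
qed

section \<open>The optimal rate for norm powers and the resulting descent\<close>

lemma xi_bar_norm_power:
  assumes "r > 1" and "a > 0"
  shows "xi_bar r (norm_power a r) g = (a * norm g) powr r"
  using assms by (simp add: xi_bar_def norm_power_def)

lemma norm_power_scaleR:
  assumes "a > 0"
  shows "norm_power a r (t *\<^sub>R g) = \<bar>t\<bar> powr r * (a * norm g) powr r / r"
  using assms by (simp add: norm_power_def abs_mult powr_mult)

lemma optimal_rate_formula_norm_power:
  assumes "r > 1" and "a > 0"
  shows "optimal_rate_formula r (norm_power a r) g =
    ((norm g)\<^sup>2 / (a * norm g) powr r) powr (1 / (r - 1))"
  using xi_bar_norm_power[OF assms, of g] by (simp add: optimal_rate_formula_def xi_bar_def)

text \<open>These are the hypotheses of \<open>power_bound_strict_min\<close> for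
  \<open>b = (norm g)\<^sup>2\<close> and \<open>c = (a * norm g) powr r\<close>: the exponent
  \<open>1 / (r - 1)\<close> in the rate is undone by raising to \<open>r - 1\<close>.\<close>

lemma optimal_rate_stationary:
  fixes g :: "real^'m"
  assumes "r > 1" and "a > 0" and "g \<noteq> 0"
  defines "\<alpha> \<equiv> optimal_rate_formula r (norm_power a r) g"
  shows "\<alpha> > 0" and "\<alpha> powr (r - 1) * (a * norm g) powr r = (norm g)\<^sup>2"
proof -
  show "\<alpha> > 0"
    using assms by (simp add: \<alpha>_def optimal_rate_formula_norm_power)
  show "\<alpha> powr (r - 1) * (a * norm g) powr r = (norm g)\<^sup>2"
    using assms by (simp add: \<alpha>_def optimal_rate_formula_norm_power powr_powr)
qed

lemma optimal_learning_rate_norm_power: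
  fixes g :: "real^'m"
  assumes "r > 1" and "a > 0"
  defines "\<alpha> \<equiv> optimal_rate_formula r (norm_power a r) g"
  shows "optimal_learning_rate (norm_power a r) g \<alpha>"
    and "g \<noteq> 0 \<Longrightarrow> optimal_learning_rate (norm_power a r) g t \<Longrightarrow> t = \<alpha>"
proof -
  let ?f = "\<lambda>t. - t * (norm g)\<^sup>2 + norm_power a r (t *\<^sub>R g)"
  have strict: "?f \<alpha> < ?f t" if "g \<noteq> 0" "t \<noteq> \<alpha>" for t
    using power_bound_strict_min[OF assms(1) optimal_rate_stationary(1)[OF assms(1,2) that(1)] _
        optimal_rate_stationary(2)[OF assms(1,2) that(1)] that(2)[unfolded \<alpha>_def]]
      optimal_rate_stationary(1)[OF assms(1,2) that(1)] that assms(2)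
    by (simp add: norm_power_scaleR \<alpha>_def)
  show "optimal_learning_rate (norm_power a r) g \<alpha>"
  proof (cases "g = 0")
    \<comment> \<open>At \<open>g = 0\<close> the objective is identically 0, so every rate is
      optimal; hence uniqueness is claimed only for nonzero \<open>g\<close>.\<close>
    case True
    then show ?thesis
      by (simp add: optimal_learning_rate_def is_arg_min_def)
  next
    case False
    then have "?f \<alpha> \<le> ?f t" for t
      using strict[of t] by (cases "t = \<alpha>") auto
    then show ?thesis
      unfolding optimal_learning_rate_def is_arg_min_linorder by blast
  qed
  show "t = \<alpha>" if "g \<noteq> 0" "optimal_learning_rate (norm_power a r) g t"
  proof (rule ccontr)
    assume "t \<noteq> \<alpha>"
    from strict[OF that(1) this] that(2) show False
      unfolding optimal_learning_rate_def is_arg_min_def by blast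
  qed
qed

text \<open>Stationarity turns the power term into \<open>\<alpha> * (norm g)\<^sup>2 / r\<close>,
  so the total is \<open>- (1 - 1 / r)\<close> times \<open>\<alpha> * (norm g)\<^sup>2\<close>, and
  \<open>1 - 1 / r\<close> is \<open>1 / r_star\<close>. It remains to identify
  \<open>\<alpha> * (norm g)\<^sup>2\<close> as a power of \<open>norm g / a\<close>.\<close>

lemma optimal_rate_decrease:
  fixes g :: "real^'m"
  assumes "r > 1" and "a > 0" and "r_star = r / (r - 1)"
  defines "\<alpha> \<equiv> optimal_rate_formula r (norm_power a r) g"
  shows "- \<alpha> * (norm g)\<^sup>2 + norm_power a r (\<alpha> *\<^sub>R g) = - (1 / r_star * (norm g / a) powr r_star)"
proof (cases "g = 0")
  case True
  then show ?thesis
    by (simp add: norm_power_def)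
next
  case False
  note st = optimal_rate_stationary[OF assms(1,2) False, folded \<alpha>_def]
  \<comment> \<open>In logarithmic coordinates the identity between powers becomes one between
    exponents, linear in \<open>x\<close> and \<open>y\<close>.\<close>
  define x y where "x = ln (norm g)" and "y = ln a"
  have xy: "norm g = exp x" "a = exp y"
    using False assms by (simp_all add: x_def y_def)
  have "\<alpha> = exp ((2 * x - r * (y + x)) / (r - 1))"
    using assms(1,2) unfolding \<alpha>_def
    by (subst optimal_rate_formula_norm_power)
      (simp_all add: xy powr_def power2_eq_square flip: exp_add exp_diff exp_minus)
  then have "\<alpha> * (norm g)\<^sup>2 = exp ((2 * x - r * (y + x)) / (r - 1) + 2 * x)"
    by (simp add: xy exp_add flip: exp_double)
  also have "(2 * x - r * (y + x)) / (r - 1) + 2 * x = r_star * (x - y)"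
    using assms(1) by (simp add: assms(3) field_simps)
  also have "exp (r_star * (x - y)) = (norm g / a) powr r_star"
    by (simp add: xy powr_def flip: exp_diff)
  finally have "\<alpha> * (norm g)\<^sup>2 = (norm g / a) powr r_star" .
  moreover have "norm_power a r (\<alpha> *\<^sub>R g) = \<alpha> * (norm g)\<^sup>2 / r"
    using st powr_mult_base[of \<alpha> "r - 1"] assms(2)
    by (simp add: norm_power_scaleR flip: st(2))
  moreover have "1 / r_star = 1 - 1 / r"
    using assms(1) by (simp add: assms(3) field_simps)
  ultimately show ?thesis
    by (simp add: left_diff_distrib)
qed

lemma batch_loss_descent:
  fixes G :: "real^'m \<Rightarrow> 'z \<Rightarrow> real" and \<theta> :: "real^'m"
  assumes "r > 1" and "a > 0" and "r_star = r / (r - 1)"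
    and "b \<noteq> {#}" and "\<And>z. z \<in># b \<Longrightarrow> H_smooth (norm_power a r) (\<lambda>\<theta>. G \<theta> z)"
  defines "g \<equiv> stoch_grad G \<theta> b"
  shows "batch_loss G (\<theta> - optimal_rate_formula r (norm_power a r) g *\<^sub>R g) b
    \<le> batch_loss G \<theta> b - 1 / r_star * (norm g / a) powr r_star"
proof -
  let ?\<alpha> = "optimal_rate_formula r (norm_power a r) g"
  have "batch_loss G (\<theta> - ?\<alpha> *\<^sub>R g) b
      \<le> batch_loss G \<theta> b + (- ?\<alpha> * (norm g)\<^sup>2 + norm_power a r (- ?\<alpha> *\<^sub>R g))"
    using H_smooth_gradient_step[OF H_smooth_batch_loss[OF assms(4,5)], where x = \<theta> and t = ?\<alpha>]
    by (simp add: g_def stoch_grad_def)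
  \<comment> \<open>The update moves along \<open>- g\<close>, while
    \<open>optimal_learning_rate\<close> evaluates the bound along \<open>g\<close>;
    \<open>norm_power\<close> is even.\<close>
  also have "norm_power a r (- ?\<alpha> *\<^sub>R g) = norm_power a r (?\<alpha> *\<^sub>R g)"
    by (simp add: norm_power_def)
  finally show ?thesis
    unfolding optimal_rate_decrease[OF assms(1-3)] by simp
qed

text \<open>The root \<open>xi_bar r (norm_power a r) g powr (1 / r)\<close> is
  \<open>a * norm g\<close>. This links the decrease in terms of \<open>norm g / a\<close> to the
  form with \<open>xi_bar\<close>.\<close>

lemma xi_bar_root_quotient:
  assumes "r > 1" and "a > 0"
  shows "(norm g)\<^sup>2 / xi_bar r (norm_power a r) g powr (1 / r) = norm g / a"
  using assms by (simp add: xi_bar_norm_power powr_powr power2_eq_square)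

text \<open>A base of at least 1 does not grow when its \<open>r\<close>-th root is taken, so
  leaving out the root only enlarges the denominator.\<close>

lemma xi_bar_quotient_le:
  assumes "r > 1" and "a > 0" and "xi_bar r (norm_power a r) g \<ge> 1"
  shows "(norm g)\<^sup>2 / xi_bar r (norm_power a r) g \<le> norm g / a"
proof -
  let ?x = "xi_bar r (norm_power a r) g"
  have "?x powr (1 / r) \<le> ?x powr 1"
    using assms by (intro powr_mono) auto
  then have "(norm g)\<^sup>2 / ?x \<le> (norm g)\<^sup>2 / ?x powr (1 / r)"
    using assms by (intro divide_left_mono) auto
  then show ?thesis
    by (simp add: xi_bar_root_quotient[OF assms(1,2)])
qed

section \<open>Measurability of the iterates\<close>

text \<open>Only the support of a batch is bounded, not its multiplicities, so there may be
  infinitely many batches; each one comes from a list over the finite set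
  \<open>set_mset s\<close>.\<close>

lemma countable_minibatches: "countable (minibatches s)"
proof -
  have "minibatches s \<subseteq> mset ` lists (set_mset s)"
  proof
    fix b assume "b \<in> minibatches s"
    moreover obtain xs where "mset xs = b"
      using ex_mset by blast
    ultimately show "b \<in> mset ` lists (set_mset s)"
      by (auto simp: minibatches_def in_lists_conv_set intro!: imageI)
  qed
  then show ?thesis
    by (rule countable_subset) (auto intro: countable_finite)
qed

lemma measurable_pair_count_space:
  assumes "f \<in> M \<rightarrow>\<^sub>M count_space A" and "g \<in> M \<rightarrow>\<^sub>M count_space B"
    and "countable A" and "countable B"
  shows "(\<lambda>\<omega>. (f \<omega>, g \<omega>)) \<in> M \<rightarrow>\<^sub>M count_space (A \<times> B)"
  using measurable_Pair[OF assms(1,2)] pair_measure_countable[OF assms(3,4)] by simp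

text \<open>Inductively, each iterate takes values in a countable set \<open>C\<close> depending on
  \<open>k\<close>. A product of countable discrete spaces is again discrete, and every function on
  a discrete space is measurable, so \<open>h\<close> may be arbitrary.\<close>

lemma recursive_measurable_count_space:
  assumes S: "\<And>k. S k \<in> M \<rightarrow>\<^sub>M count_space B" and B: "countable B"
    and 0: "\<And>\<omega>. \<omega> \<in> space M \<Longrightarrow> \<theta> 0 \<omega> = c"
    and Suc: "\<And>k \<omega>. \<omega> \<in> space M \<Longrightarrow> \<theta> (Suc k) \<omega> = h (\<theta> k \<omega>) (S k \<omega>)"
  shows "\<exists>C. countable C \<and> \<theta> k \<in> M \<rightarrow>\<^sub>M count_space C"
proof (induction k)
  case 0
  have "\<theta> 0 \<in> M \<rightarrow>\<^sub>M count_space {c} \<longleftrightarrow> (\<lambda>_. c) \<in> M \<rightarrow>\<^sub>M count_space {c}"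
    by (rule measurable_cong) (rule assms(3))
  then show ?case
    by (intro exI[of _ "{c}"]) auto
next
  case (Suc k)
  then obtain C where C: "countable C" "\<theta> k \<in> M \<rightarrow>\<^sub>M count_space C"
    by blast
  let ?h = "\<lambda>p. h (fst p) (snd p)"
  have "?h \<in> count_space (C \<times> B) \<rightarrow>\<^sub>M count_space (?h ` (C \<times> B))"
    by (auto simp: measurable_def)
  from measurable_compose[OF measurable_pair_count_space[OF C(2) S C(1) B] this]
  have "(\<lambda>\<omega>. h (\<theta> k \<omega>) (S k \<omega>)) \<in> M \<rightarrow>\<^sub>M count_space (?h ` (C \<times> B))"
    by simp
  moreover have "\<theta> (Suc k) \<in> M \<rightarrow>\<^sub>M count_space (?h ` (C \<times> B)) \<longleftrightarrow>
      (\<lambda>\<omega>. h (\<theta> k \<omega>) (S k \<omega>)) \<in> M \<rightarrow>\<^sub>M count_space (?h ` (C \<times> B))"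
    by (rule measurable_cong) (rule assms(4))
  moreover have "countable (?h ` (C \<times> B))"
    using C(1) B by (intro countable_image countable_SIGMA)
  ultimately show ?case
    by blast
qed

text \<open>The second assumption makes the rate a function \<open>A\<close> of the current iterate
  and batch, so that one step has the form
  \<open>h (\<theta> k \<omega>) (S k \<omega>)\<close>.\<close>

lemma sgd_run_measurable:
  fixes f :: "'p::real_inner \<Rightarrow> 'z multiset \<Rightarrow> real"
  assumes "sgd_run M G s \<theta>\<^sub>0 \<alpha> S \<theta>"
    and "\<And>k \<omega>. \<omega> \<in> space M \<Longrightarrow> \<alpha> k \<omega> = A (\<theta> k \<omega>) (S k \<omega>)"
  shows "(\<lambda>\<omega>. f (\<theta> k \<omega>) (S k \<omega>)) \<in> borel_measurable M"
proof -
  have S: "S k \<in> M \<rightarrow>\<^sub>M count_space (minibatches s)" for k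
    using assms(1) by (simp add: sgd_run_def)
  have "\<exists>C. countable C \<and> \<theta> k \<in> M \<rightarrow>\<^sub>M count_space C"
    using assms
    by (intro recursive_measurable_count_space[OF S countable_minibatches,
          where c = \<theta>\<^sub>0 and h = "\<lambda>x b. x - A x b *\<^sub>R stoch_grad G x b"])
      (auto simp: sgd_run_def)
  then obtain C where C: "countable C" "\<theta> k \<in> M \<rightarrow>\<^sub>M count_space C"
    by blast
  have "(\<lambda>p. f (fst p) (snd p)) \<in> borel_measurable (count_space (C \<times> minibatches s))"
    by simp
  from measurable_compose[OF measurable_pair_count_space[OF C(2) S C(1) countable_minibatches] this]
  show ?thesis by simp
qed

section \<open>Telescoping and iteration counts\<close>

text \<open>The telescoping is done on almost every path before integrating, so the potential
  \<open>V\<close> itself is never integrated. The bound \<open>v - l\<close> is the largest total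
  drop that \<open>V\<close> can make.\<close>

lemma potential_integral_bound:
  fixes X V :: "nat \<Rightarrow> 'w \<Rightarrow> real"
  assumes "prob_space M"
    and meas: "\<And>k. X k \<in> borel_measurable M"
    and nonneg: "\<And>k \<omega>. 0 \<le> X k \<omega>"
    and start: "\<And>\<omega>. \<omega> \<in> space M \<Longrightarrow> V 0 \<omega> \<le> v"
    and lower: "\<And>k \<omega>. l \<le> V k \<omega>"
    and step: "\<And>k. AE \<omega> in M. X k \<omega> \<le> V k \<omega> - V (Suc k) \<omega>"
  shows "integrable M (X k)" and "(\<Sum>k<N. \<integral>\<omega>. X k \<omega> \<partial>M) \<le> v - l"
proof -
  interpret prob_space M by fact
  have sum_le: "AE \<omega> in M. (\<Sum>k<N. X k \<omega>) \<le> v - l" for N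
  proof -
    have "AE \<omega> in M. \<forall>k. X k \<omega> \<le> V k \<omega> - V (Suc k) \<omega>"
      using step by (simp add: AE_all_countable)
    then show ?thesis
    proof (rule AE_mp, intro AE_I2 impI)
      fix \<omega> assume "\<omega> \<in> space M" and *: "\<forall>k. X k \<omega> \<le> V k \<omega> - V (Suc k) \<omega>"
      have "(\<Sum>k<N. X k \<omega>) \<le> (\<Sum>k<N. V k \<omega> - V (Suc k) \<omega>)"
        using * by (intro sum_mono) auto
      also have "\<dots> = V 0 \<omega> - V N \<omega>"
        by (rule sum_lessThan_telescope')
      finally show "(\<Sum>k<N. X k \<omega>) \<le> v - l"
        using start[OF \<open>\<omega> \<in> space M\<close>] lower[of N \<omega>] by linarith
    qed
  qed
  have int: "integrable M (X k)" for k
  proof (rule integrable_const_bound)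
    \<comment> \<open>By nonnegativity the single term \<open>X k\<close> is at most the partial sum
      ending with it, hence essentially bounded.\<close>
    show "AE \<omega> in M. norm (X k \<omega>) \<le> v - l"
      using sum_le[of "Suc k"]
    proof (rule AE_mp, intro AE_I2 impI)
      fix \<omega> assume "(\<Sum>j<Suc k. X j \<omega>) \<le> v - l"
      moreover have "0 \<le> (\<Sum>j<k. X j \<omega>)"
        by (intro sum_nonneg nonneg)
      ultimately show "norm (X k \<omega>) \<le> v - l"
        using nonneg[of k \<omega>] by simp
    qed
  qed (rule meas)
  then show "integrable M (X k)" .
  have "(\<Sum>k<N. \<integral>\<omega>. X k \<omega> \<partial>M) = (\<integral>\<omega>. (\<Sum>k<N. X k \<omega>) \<partial>M)"
    using int by simp
  also have "\<dots> \<le> (\<integral>\<omega>. v - l \<partial>M)"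
    using int sum_le by (intro integral_mono_AE) auto
  finally show "(\<Sum>k<N. \<integral>\<omega>. X k \<omega> \<partial>M) \<le> v - l"
    by (simp add: prob_space)
qed

text \<open>For \<open>\<epsilon>\<close> below 1 the power \<open>\<epsilon> powr (- p)\<close> is
  at least 1. It thus absorbs the rounding up and the successor, one unit each, whence the constant
  \<open>\<bar>C\<bar> + 2\<close>.\<close>

lemma iteration_count_bigo:
  fixes C p :: real
  assumes "p > 0"
  shows "(\<lambda>\<epsilon>. real (Suc (nat \<lceil>C * \<epsilon> powr (- p)\<rceil>))) \<in> O[at_right 0](\<lambda>\<epsilon>. \<epsilon> powr (- p))"
proof (rule bigoI)
  have "eventually (\<lambda>\<epsilon>::real. \<epsilon> \<in> {0<..<1}) (at_right 0)"
    by (intro eventually_at_right_real) simp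
  then show "eventually (\<lambda>\<epsilon>. norm (real (Suc (nat \<lceil>C * \<epsilon> powr (- p)\<rceil>)))
    \<le> (\<bar>C\<bar> + 2) * norm (\<epsilon> powr (- p))) (at_right 0)"
  proof eventually_elim
    case (elim \<epsilon>)
    have "1 \<le> \<epsilon> powr (- p)"
      using elim assms powr_mono'[of "- p" 0 \<epsilon>] by simp
    moreover have "real (nat \<lceil>C * \<epsilon> powr (- p)\<rceil>) \<le> \<bar>C * \<epsilon> powr (- p)\<bar> + 1"
      by linarith
    ultimately show ?case
      by (simp add: abs_mult algebra_simps)
  qed
qed

lemma average_le_powr:
  fixes E :: "nat \<Rightarrow> real"
  assumes "\<epsilon> > 0" and "(\<Sum>k<N. E k) \<le> C" and "N \<ge> Suc (nat \<lceil>C * \<epsilon> powr (- p)\<rceil>)"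
  shows "(\<Sum>k<N. E k) / real N \<le> \<epsilon> powr p" and "\<exists>k<N. E k \<le> \<epsilon> powr p"
proof -
  \<comment> \<open>The successor in the bound on \<open>N\<close> keeps \<open>N\<close> positive
    even if \<open>C\<close> is 0; otherwise there would be no index \<open>k < N\<close> to
    choose.\<close>
  have N: "N > 0"
    using assms(3) by simp
  have "C * \<epsilon> powr (- p) \<le> real N"
    using assms(3) by linarith
  then have "C * \<epsilon> powr (- p) * \<epsilon> powr p \<le> real N * \<epsilon> powr p"
    by (rule mult_right_mono) simp
  then have "C \<le> real N * \<epsilon> powr p"
    using assms(1) by (simp add: mult.assoc flip: powr_add)
  with assms(2) N show avg: "(\<Sum>k<N. E k) / real N \<le> \<epsilon> powr p"
    by (simp add: field_simps)
  show "\<exists>k<N. E k \<le> \<epsilon> powr p"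
  proof (rule ccontr)
    assume "\<not> ?thesis"
    then have "(\<Sum>k<N. \<epsilon> powr p) < (\<Sum>k<N. E k)"
      using N by (intro sum_strict_mono) auto
    with avg N show False
      by (simp add: field_simps)
  qed
qed

section \<open>Convergence of the SGD run\<close>

text \<open>The full loss serves as potential: the selection condition transfers the decrease on the
  batch to it. Integrability is recorded because the integral of a non-integrable function is 0 by
  default, which would make a bound on it empty.\<close>

lemma sgd_gradient_sum_bound:
  fixes G :: "real^'m \<Rightarrow> 'z \<Rightarrow> real" and M :: "'w measure"
  assumes "r > 1" and "a > 0" and r_star: "r_star = r / (r - 1)" and "\<beta> > 0"
    and smooth: "\<And>z. z \<in># s \<Longrightarrow> H_smooth (norm_power a r) (\<lambda>\<theta>. G \<theta> z)"
    and lower: "\<And>x. l \<le> full_loss G x s"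
    and "prob_space M"
    and run: "sgd_run M G s \<theta>\<^sub>0 \<alpha> S \<theta>"
    and rate: "\<And>k \<omega>. \<omega> \<in> space M \<Longrightarrow>
      \<alpha> k \<omega> = optimal_rate_formula r (norm_power a r) (stoch_grad G (\<theta> k \<omega>) (S k \<omega>))"
    and select: "\<And>k. AE \<omega> in M. full_loss G (\<theta> (Suc k) \<omega>) s - full_loss G (\<theta> k \<omega>) s
      \<le> \<beta> * (batch_loss G (\<theta> (Suc k) \<omega>) (S k \<omega>) - batch_loss G (\<theta> k \<omega>) (S k \<omega>))"
  shows "integrable M (\<lambda>\<omega>. norm (stoch_grad G (\<theta> k \<omega>) (S k \<omega>)) powr r_star)"
    and "(\<Sum>k<N. \<integral>\<omega>. norm (stoch_grad G (\<theta> k \<omega>) (S k \<omega>)) powr r_star \<partial>M)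
      \<le> (full_loss G \<theta>\<^sub>0 s - l) * (r_star * a powr r_star) / \<beta>"
proof -
  \<comment> \<open>The coefficient of \<open>norm g powr r_star\<close> in \<open>\<beta>\<close>
    times the decrease \<open>1 / r_star * (norm g / a) powr r_star\<close>.\<close>
  define c where "c = \<beta> / (r_star * a powr r_star)"
  have c: "c > 0"
    using assms by (simp add: c_def)
  let ?X = "\<lambda>k \<omega>. c * norm (stoch_grad G (\<theta> k \<omega>) (S k \<omega>)) powr r_star"
  let ?V = "\<lambda>k \<omega>. full_loss G (\<theta> k \<omega>) s"
  have meas: "?X k \<in> borel_measurable M" for k
    by (intro borel_measurable_times borel_measurable_const
        sgd_run_measurable[OF run, where f = "\<lambda>x b. norm (stoch_grad G x b) powr r_star"]) (rule rate)
  have start: "?V 0 \<omega> \<le> full_loss G \<theta>\<^sub>0 s" if "\<omega> \<in> space M" for \<omega>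
    using run that by (simp add: sgd_run_def)
  have step: "AE \<omega> in M. ?X k \<omega> \<le> ?V k \<omega> - ?V (Suc k) \<omega>" for k
    using select[of k]
  proof (rule AE_mp, intro AE_I2 impI)
    fix \<omega> assume \<omega>: "\<omega> \<in> space M"
      and sel: "full_loss G (\<theta> (Suc k) \<omega>) s - full_loss G (\<theta> k \<omega>) s
        \<le> \<beta> * (batch_loss G (\<theta> (Suc k) \<omega>) (S k \<omega>) - batch_loss G (\<theta> k \<omega>) (S k \<omega>))"
    let ?g = "stoch_grad G (\<theta> k \<omega>) (S k \<omega>)"
    have "S k \<omega> \<in> minibatches s"
      using run \<omega> measurable_space[of "S k" M "count_space (minibatches s)" \<omega>]
      by (simp add: sgd_run_def)
    then have b: "S k \<omega> \<noteq> {#}" "\<And>z. z \<in># S k \<omega> \<Longrightarrow> H_smooth (norm_power a r) (\<lambda>\<theta>. G \<theta> z)"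
      using smooth by (auto simp: minibatches_def)
    have "batch_loss G (\<theta> (Suc k) \<omega>) (S k \<omega>) - batch_loss G (\<theta> k \<omega>) (S k \<omega>)
        \<le> - (1 / r_star * (norm ?g / a) powr r_star)"
      using batch_loss_descent[OF assms(1-3), where G = G and \<theta> = "\<theta> k \<omega>", OF b] run \<omega> rate
      by (simp add: sgd_run_def)
    then have "\<beta> * (batch_loss G (\<theta> (Suc k) \<omega>) (S k \<omega>) - batch_loss G (\<theta> k \<omega>) (S k \<omega>))
        \<le> \<beta> * - (1 / r_star * (norm ?g / a) powr r_star)"
      using \<open>\<beta> > 0\<close> by (intro mult_left_mono) auto
    also have "\<dots> = - ?X k \<omega>"
      using \<open>a > 0\<close> by (simp add: c_def powr_divide)
    finally show "?X k \<omega> \<le> ?V k \<omega> - ?V (Suc k) \<omega>"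
      using sel by linarith
  qed
  have nonneg: "0 \<le> ?X k \<omega>" for k \<omega>
    using c by simp
  note bound = potential_integral_bound[where X = ?X and V = ?V,
      OF \<open>prob_space M\<close> meas nonneg start lower step]
  show "integrable M (\<lambda>\<omega>. norm (stoch_grad G (\<theta> k \<omega>) (S k \<omega>)) powr r_star)"
    using bound(1)[of k] c by simp
  have "c * (\<Sum>k<N. \<integral>\<omega>. norm (stoch_grad G (\<theta> k \<omega>) (S k \<omega>)) powr r_star \<partial>M)
      \<le> full_loss G \<theta>\<^sub>0 s - l"
    using bound(2)[of N] by (simp add: sum_distrib_left)
  then have "(\<Sum>k<N. \<integral>\<omega>. norm (stoch_grad G (\<theta> k \<omega>) (S k \<omega>)) powr r_star \<partial>M)
      \<le> (full_loss G \<theta>\<^sub>0 s - l) / c"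
    using c by (simp add: field_simps)
  then show "(\<Sum>k<N. \<integral>\<omega>. norm (stoch_grad G (\<theta> k \<omega>) (S k \<omega>)) powr r_star \<partial>M)
      \<le> (full_loss G \<theta>\<^sub>0 s - l) * (r_star * a powr r_star) / \<beta>"
    by (simp add: c_def)
qed

text \<open>\<open>T\<close> is chosen before the probability space and the run, so one iteration
  count serves all laws of the batches. The accuracy is reached by the average over the first
  \<open>N\<close> steps, and hence by at least one of them.\<close>

theorem proposition4:
  fixes G :: "real^'m \<Rightarrow> 'z \<Rightarrow> real" and \<xi> :: "real^'m \<Rightarrow> real"
    and Z :: "'z set" and s :: "'z multiset" and a r r_star :: real
  assumes "r > 1" and "a > 0"
    and "\<xi> = norm_power a r"
    and "r_star = r / (r - 1)"
    and "s \<noteq> {#}" and "set_mset s \<subseteq> Z"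
    and "\<And>z. z \<in> Z \<Longrightarrow> H_smooth \<xi> (\<lambda>\<theta>. G \<theta> z)"
  shows
    "(\<forall>\<theta>\<^sub>k \<theta>\<^sub>k' s\<^sub>k g \<alpha>.
        s\<^sub>k \<in> minibatches s \<longrightarrow>
        g = stoch_grad G \<theta>\<^sub>k s\<^sub>k \<longrightarrow>
        \<alpha> = optimal_rate_formula r \<xi> g \<longrightarrow>
        \<theta>\<^sub>k' = \<theta>\<^sub>k - \<alpha> *\<^sub>R g \<longrightarrow>
        optimal_learning_rate \<xi> g \<alpha> \<and>
        (g \<noteq> 0 \<longrightarrow> (\<forall>t. optimal_learning_rate \<xi> g t \<longrightarrow> t = \<alpha>)) \<and>
        batch_loss G \<theta>\<^sub>k' s\<^sub>k \<le> batch_loss G \<theta>\<^sub>k s\<^sub>k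
          - 1 / r_star * ((norm g)\<^sup>2 / xi_bar r \<xi> g powr (1 / r)) powr r_star \<and>
        (xi_bar r \<xi> g \<ge> 1 \<longrightarrow>
          batch_loss G \<theta>\<^sub>k' s\<^sub>k \<le> batch_loss G \<theta>\<^sub>k s\<^sub>k
            - 1 / r_star * ((norm g)\<^sup>2 / xi_bar r \<xi> g) powr r_star))
     \<and>
     (\<forall>\<theta>\<^sub>0 \<beta>.
        \<beta> > 0 \<longrightarrow>
        (\<exists>\<theta>_min. is_arg_min (\<lambda>\<theta>. full_loss G \<theta> s) (\<lambda>_. True) \<theta>_min) \<longrightarrow>
        (\<exists>T :: real \<Rightarrow> nat.
           (\<lambda>\<epsilon>. real (T \<epsilon>)) \<in> O[at_right 0](\<lambda>\<epsilon>. \<epsilon> powr (- r_star)) \<and>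
           (\<forall>(M :: 'w measure) \<alpha> S \<theta>.
              prob_space M \<longrightarrow>
              sgd_run M G s \<theta>\<^sub>0 \<alpha> S \<theta> \<longrightarrow>
              (\<forall>k. \<forall>\<omega>\<in>space M.
                 \<alpha> k \<omega> = optimal_rate_formula r \<xi> (stoch_grad G (\<theta> k \<omega>) (S k \<omega>))) \<longrightarrow>
              (\<forall>k. AE \<omega> in M.
                 full_loss G (\<theta> (Suc k) \<omega>) s - full_loss G (\<theta> k \<omega>) s
                 \<le> \<beta> * (batch_loss G (\<theta> (Suc k) \<omega>) (S k \<omega>)
                          - batch_loss G (\<theta> k \<omega>) (S k \<omega>))) \<longrightarrow>
              (\<forall>k. integrable M (\<lambda>\<omega>. norm (stoch_grad G (\<theta> k \<omega>) (S k \<omega>)) powr r_star)) \<and>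
              (\<forall>\<epsilon>>0. \<forall>N\<ge>T \<epsilon>.
                 (\<Sum>k<N. \<integral>\<omega>. norm (stoch_grad G (\<theta> k \<omega>) (S k \<omega>)) powr r_star \<partial>M) / real N
                   \<le> \<epsilon> powr r_star \<and>
                 (\<exists>k<N. (\<integral>\<omega>. norm (stoch_grad G (\<theta> k \<omega>) (S k \<omega>)) powr r_star \<partial>M)
                   \<le> \<epsilon> powr r_star)))))"
proof (intro conjI allI impI)
  have smooth: "H_smooth (norm_power a r) (\<lambda>\<theta>. G \<theta> z)" if "z \<in># s" for z
    using assms that by blast
  have r_star: "r_star > 0"
    using assms by simp
  {
    fix \<theta>\<^sub>k \<theta>\<^sub>k' s\<^sub>k g \<alpha>
    assume b: "s\<^sub>k \<in> minibatches s" and g: "g = stoch_grad G \<theta>\<^sub>k s\<^sub>k"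
      and \<alpha>: "\<alpha> = optimal_rate_formula r \<xi> g" and \<theta>': "\<theta>\<^sub>k' = \<theta>\<^sub>k - \<alpha> *\<^sub>R g"
    show "optimal_learning_rate \<xi> g \<alpha>"
      using optimal_learning_rate_norm_power(1)[OF assms(1,2)] by (simp add: \<alpha> assms(3))
    show "t = \<alpha>" if "g \<noteq> 0" "optimal_learning_rate \<xi> g t" for t
      using optimal_learning_rate_norm_power(2)[OF assms(1,2)] that by (simp add: \<alpha> assms(3))
    have descent: "batch_loss G \<theta>\<^sub>k' s\<^sub>k \<le> batch_loss G \<theta>\<^sub>k s\<^sub>k - 1 / r_star * (norm g / a) powr r_star"
      using b smooth unfolding \<theta>' \<alpha> g assms(3)
      by (intro batch_loss_descent[OF assms(1,2,4)]) (auto simp: minibatches_def)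
    then show "batch_loss G \<theta>\<^sub>k' s\<^sub>k \<le> batch_loss G \<theta>\<^sub>k s\<^sub>k
        - 1 / r_star * ((norm g)\<^sup>2 / xi_bar r \<xi> g powr (1 / r)) powr r_star"
      by (simp add: assms(3) xi_bar_root_quotient[OF assms(1,2)])
    show "batch_loss G \<theta>\<^sub>k' s\<^sub>k \<le> batch_loss G \<theta>\<^sub>k s\<^sub>k
        - 1 / r_star * ((norm g)\<^sup>2 / xi_bar r \<xi> g) powr r_star" if x: "xi_bar r \<xi> g \<ge> 1"
    proof -
      \<comment> \<open>Without the root the claimed decrease is no larger than the one already
        proved.\<close>
      have "((norm g)\<^sup>2 / xi_bar r \<xi> g) powr r_star \<le> (norm g / a) powr r_star"
        using xi_bar_quotient_le[OF assms(1,2) x[unfolded assms(3)]] r_star x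
        by (intro powr_mono2) (auto simp: assms(3))
      then have "1 / r_star * ((norm g)\<^sup>2 / xi_bar r \<xi> g) powr r_star
          \<le> 1 / r_star * (norm g / a) powr r_star"
        using r_star by (intro mult_left_mono) auto
      with descent show ?thesis by linarith
    qed
  }
  fix \<theta>\<^sub>0 \<beta>
  assume \<beta>: "\<beta> > (0::real)" and "\<exists>\<theta>_min. is_arg_min (\<lambda>\<theta>. full_loss G \<theta> s) (\<lambda>_. True) \<theta>_min"
  then obtain \<theta>_min where lower: "\<And>x. full_loss G \<theta>_min s \<le> full_loss G x s"
    unfolding is_arg_min_linorder by blast
  \<comment> \<open>The bound of \<open>sgd_gradient_sum_bound\<close> with the minimum value of the
    full loss as \<open>l\<close>; it involves neither the measure nor the run.\<close>
  define C where "C = (full_loss G \<theta>\<^sub>0 s - full_loss G \<theta>_min s) * (r_star * a powr r_star) / \<beta>"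
  show "\<exists>T :: real \<Rightarrow> nat.
           (\<lambda>\<epsilon>. real (T \<epsilon>)) \<in> O[at_right 0](\<lambda>\<epsilon>. \<epsilon> powr (- r_star)) \<and>
           (\<forall>(M :: 'w measure) \<alpha> S \<theta>.
              prob_space M \<longrightarrow>
              sgd_run M G s \<theta>\<^sub>0 \<alpha> S \<theta> \<longrightarrow>
              (\<forall>k. \<forall>\<omega>\<in>space M.
                 \<alpha> k \<omega> = optimal_rate_formula r \<xi> (stoch_grad G (\<theta> k \<omega>) (S k \<omega>))) \<longrightarrow>
              (\<forall>k. AE \<omega> in M.
                 full_loss G (\<theta> (Suc k) \<omega>) s - full_loss G (\<theta> k \<omega>) s
                 \<le> \<beta> * (batch_loss G (\<theta> (Suc k) \<omega>) (S k \<omega>)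
                          - batch_loss G (\<theta> k \<omega>) (S k \<omega>))) \<longrightarrow>
              (\<forall>k. integrable M (\<lambda>\<omega>. norm (stoch_grad G (\<theta> k \<omega>) (S k \<omega>)) powr r_star)) \<and>
              (\<forall>\<epsilon>>0. \<forall>N\<ge>T \<epsilon>.
                 (\<Sum>k<N. \<integral>\<omega>. norm (stoch_grad G (\<theta> k \<omega>) (S k \<omega>)) powr r_star \<partial>M) / real N
                   \<le> \<epsilon> powr r_star \<and>
                 (\<exists>k<N. (\<integral>\<omega>. norm (stoch_grad G (\<theta> k \<omega>) (S k \<omega>)) powr r_star \<partial>M)
                   \<le> \<epsilon> powr r_star)))" (is "\<exists>T. ?P T")
  \<comment> \<open>The sum of expectations is at most \<open>C\<close>, so the average falls to
    \<open>\<epsilon> powr r_star\<close> once \<open>N\<close> reaches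
    \<open>C * \<epsilon> powr (- r_star)\<close>.\<close>
  proof (intro exI[of ?P "\<lambda>\<epsilon>. Suc (nat \<lceil>C * \<epsilon> powr (- r_star)\<rceil>)"] conjI[OF iteration_count_bigo[OF r_star]]
      allI impI)
    fix M :: "'w measure" and \<alpha> S \<theta>
    assume "prob_space M" and "sgd_run M G s \<theta>\<^sub>0 \<alpha> S \<theta>"
      and rate: "\<forall>k. \<forall>\<omega>\<in>space M. \<alpha> k \<omega> = optimal_rate_formula r \<xi> (stoch_grad G (\<theta> k \<omega>) (S k \<omega>))"
      and select: "\<forall>k. AE \<omega> in M. full_loss G (\<theta> (Suc k) \<omega>) s - full_loss G (\<theta> k \<omega>) s
        \<le> \<beta> * (batch_loss G (\<theta> (Suc k) \<omega>) (S k \<omega>) - batch_loss G (\<theta> k \<omega>) (S k \<omega>))"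
    let ?E = "\<lambda>k. \<integral>\<omega>. norm (stoch_grad G (\<theta> k \<omega>) (S k \<omega>)) powr r_star \<partial>M"
    note bound = sgd_gradient_sum_bound[OF assms(1,2,4) \<beta> smooth lower \<open>prob_space M\<close>
        \<open>sgd_run M G s \<theta>\<^sub>0 \<alpha> S \<theta>\<close> rate[unfolded assms(3), rule_format] select[rule_format],
        folded C_def]
    have "(\<Sum>k<N. ?E k) / real N \<le> \<epsilon> powr r_star" "\<exists>k<N. ?E k \<le> \<epsilon> powr r_star"
      if "\<epsilon> > 0" "N \<ge> Suc (nat \<lceil>C * \<epsilon> powr (- r_star)\<rceil>)" for \<epsilon> N
      using average_le_powr[OF that(1) bound(2) that(2)] by auto
    then show "(\<forall>k. integrable M (\<lambda>\<omega>. norm (stoch_grad G (\<theta> k \<omega>) (S k \<omega>)) powr r_star)) \<and>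
        (\<forall>\<epsilon>>0. \<forall>N\<ge>Suc (nat \<lceil>C * \<epsilon> powr (- r_star)\<rceil>).
          (\<Sum>k<N. ?E k) / real N \<le> \<epsilon> powr r_star \<and> (\<exists>k<N. ?E k \<le> \<epsilon> powr r_star))"
      using bound(1) by blast
  qed
qed

end
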